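(* Every square complex matrix $T$ with $\|T\|<1$ (operator norm) has a fractured Nelson dilation $\widehat{T}$.
   Context: $\mathbb{D}$ is the open unit disk and $\mathbb{T}$ the unit circle in $\mathbb{C}$. Nelson dilation: Let $T$ be an $n\times n$ complex matrix with $\|T\|<1$. Write $T=U\,\mathrm{diag}(s_1,\dots,s_n)\,V^*$ with $U,V$ unitary and (phased) singular values $s_1,\dots,s_n\in\mathbb{D}$ (the $s_i$ may be complex). Let $b_1,\dots,b_n$ be automorphisms of $\mathbb{D}$, $b_i(z)=\lambda_i\frac{z+a_i}{1+\bar a_i z}$ with $\lambda_i\in\mathbb{T}$, $a_i\in\mathbb{D}$, such that $b_i(0)=s_i$ for all $i$. Any matrix-valued function of the form $\widehat{T}(z)=U\,\mathrm{diag}(b_1(z),\dots,b_n(z))\,V^*$ arising this way is called a Nelson dilation of $T$; it satisfies $\widehat{T}(0)=T$. Let $\mathbb{D}_T$ be the largest open disk centered at $0$ on which every $b_i$ is analytic (all of $\mathbb{C}$ if every $a_i=0$); then $\overline{\mathbb{D}}\subseteq\mathbb{D}_T$. The exceptional set of $\widehat{T}$ is $S_{\widehat{T}}=\{z\in\mathbb{D}_T:\widehat{T}(z)\text{ has a repeated eigenvalue}\}$, where a repeated eigenvalue is a multiple root of the characteristic polynomial. The Nelson dilation $\widehat{T}$ is called fractured if $S_{\widehat{T}}$ is finite. *)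

theory Defs
  imports
    "HOL-Analysis.Complex_Analysis_Basics"
    "Jordan_Normal_Form.Schur_Decomposition"
begin

definition l2_norm :: "complex Matrix.vec \<Rightarrow> real" where
  "l2_norm v = L2_set (\<lambda>i. cmod (vec_index v i)) {..<dim_vec v}"

(* The unit ball, rather than the unit sphere, keeps the supremum over a
   nonempty set for 0 x 0 matrices. *)
definition op_norm :: "complex mat \<Rightarrow> real" where
  "op_norm A = (SUP v\<in>{v \<in> carrier_vec (dim_col A). l2_norm v \<le> 1}. l2_norm (A *\<^sub>v v))"

definition unitary_mat :: "nat \<Rightarrow> complex mat \<Rightarrow> bool" where
  "unitary_mat n U \<longleftrightarrow>
     U \<in> carrier_mat n n \<and> mat_adjoint U * U = 1\<^sub>m n \<and> U * mat_adjoint U = 1\<^sub>m n"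

(* An automorphism of the unit disk, extended to the complex plane by its rational formula.
   If a is nonzero, the value at the pole -1 / cnj a is 0 because x / 0 = 0; the numerator does
   not vanish there, so the function is unbounded near the pole and hence not analytic at it. *)
definition disk_automorphism :: "(complex \<Rightarrow> complex) \<Rightarrow> bool" where
  "disk_automorphism b \<longleftrightarrow>
     (\<exists>l a. cmod l = 1 \<and> cmod a < 1 \<and> b = (\<lambda>z. l * ((z + a) / (1 + cnj a * z))))"

definition nelson_dilation ::
    "nat \<Rightarrow> complex mat \<Rightarrow> complex mat \<Rightarrow> (nat \<Rightarrow> complex \<Rightarrow> complex) \<Rightarrow> complex \<Rightarrow> complex mat" where
  "nelson_dilation n U V b z = U * mat_diag n (\<lambda>i. b i z) * mat_adjoint V"

(* The data (U, V, s, b) presents nelson_dilation n U V b as a Nelson dilation of T. The indices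
   1..n are shifted to 0..n-1. The s i are arbitrary points of the disk, so the condition on T
   says exactly that they are singular values of T up to unimodular factors. *)
definition nelson_data ::
    "nat \<Rightarrow> complex mat \<Rightarrow> complex mat \<Rightarrow> complex mat \<Rightarrow> (nat \<Rightarrow> complex) \<Rightarrow>
     (nat \<Rightarrow> complex \<Rightarrow> complex) \<Rightarrow> bool" where
  "nelson_data n T U V s b \<longleftrightarrow>
     unitary_mat n U \<and> unitary_mat n V \<and>
     T = U * mat_diag n s * mat_adjoint V \<and>
     (\<forall>i<n. cmod (s i) < 1 \<and> disk_automorphism (b i) \<and> b i 0 = s i)"

(* The largest open disk centered at 0 on which all b i are analytic, as the union of all such
   disks; it is the whole plane if there is no bound on their radii. *)
definition nelson_domain :: "nat \<Rightarrow> (nat \<Rightarrow> complex \<Rightarrow> complex) \<Rightarrow> complex set" where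
  "nelson_domain n b = \<Union>{ball 0 r | r. \<forall>i<n. b i analytic_on ball 0 r}"

definition repeated_eigenvalue :: "complex mat \<Rightarrow> bool" where
  "repeated_eigenvalue A \<longleftrightarrow> (\<exists>x. order x (char_poly A) \<ge> 2)"

definition exceptional_set ::
    "nat \<Rightarrow> complex mat \<Rightarrow> complex mat \<Rightarrow> (nat \<Rightarrow> complex \<Rightarrow> complex) \<Rightarrow> complex set" where
  "exceptional_set n U V b =
     {z \<in> nelson_domain n b. repeated_eigenvalue (nelson_dilation n U V b z)}"

definition fractured ::
    "nat \<Rightarrow> complex mat \<Rightarrow> complex mat \<Rightarrow> (nat \<Rightarrow> complex \<Rightarrow> complex) \<Rightarrow> bool" where
  "fractured n U V b \<longleftrightarrow> finite (exceptional_set n U V b)"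

end

theory Submission
  imports
    Defs
    "Jordan_Normal_Form.Jordan_Normal_Form_Existence"
    "Jordan_Normal_Form.Spectral_Radius"
    "Subresultants.Subresultant_Gcd"
    "HOL-Computational_Algebra.Field_as_Ring"
begin

text \<open>
  Write \<open>T = U diag(s) V\<^sup>*\<close> and \<open>W = V\<^sup>* U\<close>. The automorphisms with \<open>b\<^sub>i(0) = s\<^sub>i\<close> are
  \<open>b\<^sub>i(z) = (\<lambda>\<^sub>i z + s\<^sub>i) / (1 + cnj s\<^sub>i \<lambda>\<^sub>i z)\<close> with \<open>\<lambda>\<^sub>i\<close> unimodular, and the choice of \<open>\<lambda>\<^sub>i\<close> makes
  \<open>b\<^sub>i(1)\<close> an arbitrary unimodular number \<open>\<mu>\<^sub>i\<close>. Up to a nonzero scalar factor, the dilation is similar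
  to a matrix with polynomial entries in \<open>z\<close>, so the discriminant of its characteristic polynomial
  has finitely many zeros as soon as \<open>diag(\<mu>) W\<close> has simple spectrum.

  Such a \<open>\<mu>\<close> exists because \<open>W\<close> is invertible. The characteristic polynomial of \<open>diag(\<mu>) W\<close> is affine
  in each \<open>\<mu>\<^sub>k\<close>; if it always has a repeated root, then one coordinate after the other the root can be
  chosen independently of \<open>\<mu>\<^sub>k\<close>, and in the end one number is an eigenvalue of \<open>diag(\<mu>) W\<close> for all
  complex \<open>\<mu>\<close>. Taking \<open>\<mu> = 0\<close> shows that this number is \<open>0\<close>, and \<open>\<mu> = 1\<close> that \<open>W\<close> is singular.
\<close>

section \<open>Diagonal multiples with simple spectrum\<close>

text \<open>Both conditions are linear in \<open>p\<close>, so in a pencil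
  \<open>a + smult t b\<close> they are affine in \<open>t\<close>; the order of a root has no such
  form. For \<open>p = 0\<close> every \<open>x\<close> qualifies, hence the nonzero hypothesis when
  passing to orders.\<close>

definition repeated_root :: "complex poly \<Rightarrow> complex \<Rightarrow> bool" where
  "repeated_root p x \<longleftrightarrow> poly p x = 0 \<and> poly (pderiv p) x = 0"

lemma repeated_root_iff_order:
  assumes "p \<noteq> 0"
  shows "repeated_root p x \<longleftrightarrow> 2 \<le> Polynomial.order x p"
proof (cases "poly p x = 0")
  case True
  then have eq: "Polynomial.order x p = Suc (Polynomial.order x (pderiv p))"
    using assms order_pderiv by blast
  have "pderiv p \<noteq> 0"
    using True assms by (metis order_0I pderiv_eq_0_iff degree_eq_zeroE order_root poly_pCons mult_zero_right add_0_right pCons_0_0 poly_0)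
  then show ?thesis
    using True eq by (auto simp: repeated_root_def order_root Suc_le_eq)
next
  case False
  then show ?thesis by (simp add: repeated_root_def order_0I)
qed

text \<open>The values at \<open>x\<close> of the pencil and of its derivative are affine functions
  of the parameter, and an affine function with two zeros vanishes identically.\<close>

lemma repeated_root_pencil_extend:
  assumes "repeated_root (a + smult s b) x" "repeated_root (a + smult t b) x" "s \<noteq> t"
  shows "repeated_root (a + smult r b) x"
proof -
  have *: "u + r * v = 0" if "u + s * v = 0" "u + t * v = 0" for u v :: complex
  proof -
    have "(s - t) * v = (u + s * v) - (u + t * v)" by (simp add: algebra_simps)
    then have "(s - t) * v = 0" using that by (simp only: diff_self)
    then have "v = 0" using assms(3) by simp
    then show ?thesis using that by simp
  qed
  show ?thesis
    using assms(1,2) * by (simp add: repeated_root_def pderiv_add pderiv_smult)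
qed

lemma wronskian_nonzero:
  fixes a b :: "complex poly"
  assumes "degree b < degree a" "b \<noteq> 0"
  shows "a * pderiv b - pderiv a * b \<noteq> 0"
proof
  assume "a * pderiv b - pderiv a * b = 0"
  then have eq: "a * pderiv b = pderiv a * b" by simp
  have lc: "lead_coeff (pderiv p) = of_nat (degree p) * lead_coeff p" if "degree p > 0" for p :: "complex poly"
    using that by (simp add: degree_pderiv coeff_pderiv)
  have a0: "a \<noteq> 0" "pderiv a \<noteq> 0" using assms(1) by (auto simp: pderiv_eq_0_iff)
  then have "pderiv b \<noteq> 0" using eq assms(2) by auto
  then have db: "degree b > 0" by (simp add: pderiv_eq_0_iff)
  \<comment> \<open>In characteristic 0 differentiation multiplies the leading coefficient by the
    degree, so cancelling the leading coefficients forces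
    \<open>degree a = degree b\<close>.\<close>
  have "lead_coeff (a * pderiv b) = lead_coeff (pderiv a * b)" using eq by simp
  then have "lead_coeff a * (of_nat (degree b) * lead_coeff b) =
      of_nat (degree a) * lead_coeff a * lead_coeff b"
    using lc[of a] lc[of b] db assms(1) by (simp only: lead_coeff_mult)
  then have "(of_nat (degree b) :: complex) = of_nat (degree a)"
    using a0 assms(2) by simp
  then show False using assms(1) by simp
qed

text \<open>A repeated root of \<open>a + t b\<close> is a zero of the Wronskian of \<open>a\<close> and \<open>b\<close>, whatever \<open>t\<close> is, so only
  finitely many values \<open>X t\<close> occur.\<close>
lemma repeated_root_pencil_pigeonhole:
  assumes "degree b < degree a" "infinite S"
    and rr: "\<And>t. t \<in> S \<Longrightarrow> repeated_root (a + smult t b) (X t)"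
  shows "\<exists>x. infinite {t \<in> S. X t = x}"
proof -
  have "finite (X ` S)"
  proof (cases "b = 0")
    case True
    have "X ` S \<subseteq> {x. poly a x = 0}"
      using rr True by (auto simp: repeated_root_def)
    moreover have "a \<noteq> 0" using assms(1) by auto
    ultimately show ?thesis using poly_roots_finite finite_subset by blast
  next
    case False
    let ?w = "a * pderiv b - pderiv a * b"
    have "poly ?w (X t) = 0" if "t \<in> S" for t
    proof -
      have "poly a (X t) = - t * poly b (X t)" "poly (pderiv a) (X t) = - t * poly (pderiv b) (X t)"
        using rr[OF that] by (simp_all add: repeated_root_def pderiv_add pderiv_smult eq_neg_iff_add_eq_0)
      then show ?thesis by simp
    qed
    then have "X ` S \<subseteq> {x. poly ?w x = 0}" by blast
    then show ?thesis
      using poly_roots_finite[OF wronskian_nonzero[OF assms(1) False]] finite_subset by blast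
  qed
  then show ?thesis
    using pigeonhole_infinite[OF assms(2)] by blast
qed

text \<open>Only row \<open>k\<close> of the characteristic matrix involves \<open>t\<close>, and it
  does so affinely. Laplace expansion along that row has cofactors independent of
  \<open>t\<close>.\<close>

lemma char_poly_mat_diag_mult_affine:
  fixes W :: "'a :: comm_ring_1 mat"
  assumes W: "W \<in> carrier_mat n n" and k: "k < n"
  obtains a b where "\<And>t. char_poly (mat_diag n (\<mu>(k := t)) * W) = a + smult t b"
proof -
  define C where "C t = char_poly_matrix (mat_diag n (\<mu>(k := t)) * W)" for t
  have C: "C t \<in> carrier_mat n n" for t
    unfolding C_def by (intro char_poly_matrix_closed mult_carrier_mat[OF mat_diag_dim W])
  have row: "C t $$ (k, j) = (if j = k then [:0, 1:] else 0) - smult t [:W $$ (k, j):]" if "j < n" for t j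
    using that k W by (auto simp: C_def char_poly_matrix_def mat_diag_mult_left[OF W])
  have other: "C t $$ (i, j) = C 0 $$ (i, j)" if "i < n" "j < n" "i \<noteq> k" for t i j
    using that k W by (auto simp: C_def char_poly_matrix_def mat_diag_mult_left[OF W])
  have minor: "mat_delete (C t) k j = mat_delete (C 0) k j" if "j < n" for t j
    using C[of t] C[of 0] k that by (intro eq_matI) (auto simp: mat_delete_def intro!: other)
  have "char_poly (mat_diag n (\<mu>(k := t)) * W) =
      (\<Sum>j<n. C t $$ (k, j) * cofactor (C 0) k j)" for t
    unfolding char_poly_def C_def[symmetric] laplace_expansion_row[OF C k]
    by (intro sum.cong refl) (simp add: cofactor_def minor[of _ t])
  also have "(\<Sum>j<n. C t $$ (k, j) * cofactor (C 0) k j) =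
      (\<Sum>j<n. (if j = k then [:0, 1:] else 0) * cofactor (C 0) k j) +
      smult t (- (\<Sum>j<n. [:W $$ (k, j):] * cofactor (C 0) k j))" for t
  proof -
    have "(\<Sum>j<n. C t $$ (k, j) * cofactor (C 0) k j) =
       (\<Sum>j<n. (if j = k then [:0, 1:] else 0) * cofactor (C 0) k j - [:t:] * ([:W $$ (k, j):] * cofactor (C 0) k j))"
      by (intro sum.cong refl) (simp add: row algebra_simps)
    also have "\<dots> = (\<Sum>j<n. (if j = k then [:0, 1:] else 0) * cofactor (C 0) k j) -
       [:t:] * (\<Sum>j<n. [:W $$ (k, j):] * cofactor (C 0) k j)"
      by (simp only: sum_subtractf sum_distrib_left)
    finally show ?thesis by simp
  qed
  finally show ?thesis by (rule that)
qed

text \<open>\<open>b\<close> is the difference of the members at \<open>t = 1\<close> and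
  \<open>t = 0\<close>, both monic of degree \<open>n\<close>, so the leading terms cancel. The case
  \<open>b = 0\<close> is where \<open>n > 0\<close> enters.\<close>

lemma degree_pencil_lt:
  fixes a b :: "complex poly"
  assumes "\<And>t. degree (a + smult t b) = n \<and> coeff (a + smult t b) n = 1" "n > 0"
  shows "degree b < degree a"
proof -
  have a: "degree a = n" "coeff a n = 1" using assms(1)[of 0] by auto
  have "coeff b n = 0" using assms(1)[of 1] a by simp
  moreover have "degree b \<le> n"
  proof -
    have "degree ((a + smult 1 b) - a) \<le> n"
      using assms(1)[of 1] a(1) by (intro degree_diff_le) auto
    then show ?thesis by simp
  qed
  ultimately show ?thesis
    using a(1) assms(2)
    by (metis degree_0 le_neq_implies_less leading_coeff_0_iff)
qed

lemma common_repeated_root: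
  fixes W :: "complex mat"
  assumes W: "W \<in> carrier_mat n n" and S: "infinite S"
    and rr: "\<And>\<mu>. (\<forall>i. \<mu> i \<in> S) \<Longrightarrow> \<exists>x. repeated_root (char_poly (mat_diag n \<mu> * W)) x"
  shows "\<exists>x. \<forall>\<mu>. repeated_root (char_poly (mat_diag n \<mu> * W)) x"
proof -
  define P where "P \<mu> = char_poly (mat_diag n \<mu> * W)" for \<mu>
  have monic: "degree (P \<mu>) = n \<and> coeff (P \<mu>) n = 1" for \<mu>
    unfolding P_def by (intro degree_monic_char_poly mult_carrier_mat[OF mat_diag_dim W])
  \<comment> \<open>Induction on the number \<open>k\<close> of freed coordinates: once the
    coordinates from \<open>k\<close> on are fixed in \<open>S\<close>, one \<open>x\<close> serves
    all complex values of the first \<open>k\<close>.\<close>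
  have claim: "\<exists>x. \<forall>\<nu>. (\<forall>i\<ge>k. \<nu> i = \<mu> i) \<longrightarrow> repeated_root (P \<nu>) x"
    if "k \<le> n" "\<forall>i\<ge>k. \<mu> i \<in> S" for k \<mu>
    using that
  proof (induction k arbitrary: \<mu>)
    case 0
    then obtain x where "repeated_root (P \<mu>) x" using rr[of \<mu>] by (auto simp: P_def)
    moreover have "\<nu> = \<mu>" if "\<forall>i\<ge>0. \<nu> i = \<mu> i" for \<nu> using that by auto
    ultimately show ?case by blast
  next
    case (Suc k)
    have kn: "k < n" "n > 0" using Suc.prems by auto
    have "\<exists>x. \<forall>\<nu>. \<nu> k = t \<and> (\<forall>i\<ge>Suc k. \<nu> i = \<mu> i) \<longrightarrow> repeated_root (P \<nu>) x" if "t \<in> S" for t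
    proof -
      have "\<exists>x. \<forall>\<nu>. (\<forall>i\<ge>k. \<nu> i = (\<mu>(k := t)) i) \<longrightarrow> repeated_root (P \<nu>) x"
        using Suc.prems that by (intro Suc.IH) auto
      then obtain x where x: "\<And>\<nu>. (\<forall>i\<ge>k. \<nu> i = (\<mu>(k := t)) i) \<Longrightarrow> repeated_root (P \<nu>) x" by blast
      show ?thesis
      proof (intro exI[of _ x] allI impI x)
        fix \<nu> i assume "\<nu> k = t \<and> (\<forall>i\<ge>Suc k. \<nu> i = \<mu> i)" "k \<le> i"
        then show "\<nu> i = (\<mu>(k := t)) i" by (cases "i = k") auto
      qed
    qed
    then obtain X where
      X: "\<And>t \<nu>. t \<in> S \<Longrightarrow> \<nu> k = t \<Longrightarrow> (\<forall>i\<ge>Suc k. \<nu> i = \<mu> i) \<Longrightarrow> repeated_root (P \<nu>) (X t)"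
      by metis
    obtain a b where ab: "\<And>t. P (\<mu>(k := t)) = a + smult t b"
      unfolding P_def using char_poly_mat_diag_mult_affine[OF W kn(1)] by blast
    have "repeated_root (a + smult t b) (X t)" if "t \<in> S" for t
      using X[OF that, of "\<mu>(k := t)"] ab by simp
    moreover have "degree b < degree a"
      using monic[of "\<mu>(k := _)"] kn(2) unfolding ab by (rule degree_pencil_lt)
    ultimately obtain x where x: "infinite {t \<in> S. X t = x}"
      using repeated_root_pencil_pigeonhole S by blast
    \<comment> \<open>The pencil in coordinate \<open>k\<close> now depends on the freed coordinates
      of \<nu>, but \<open>x\<close> does not. Two distinct parameters in \<open>S\<close> with the
      same root \<open>x\<close> free coordinate \<open>k\<close> as well.\<close>
    have "repeated_root (P \<nu>) x" if \<nu>: "\<forall>i\<ge>Suc k. \<nu> i = \<mu> i" for \<nu>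
    proof -
      obtain c d where cd: "\<And>t. P (\<nu>(k := t)) = c + smult t d"
        unfolding P_def using char_poly_mat_diag_mult_affine[OF W kn(1)] by blast
      have "{t \<in> S. X t = x} \<noteq> {}" using x by (metis finite.emptyI)
      then obtain s where s: "s \<in> S" "X s = x" by auto
      obtain t where t: "t \<in> S" "X t = x" "t \<noteq> s"
      proof -
        have "infinite ({t \<in> S. X t = x} - {s})" using x by simp
        then have "{t \<in> S. X t = x} - {s} \<noteq> {}" by (metis finite.emptyI)
        then show ?thesis using that by auto
      qed
      have rep: "repeated_root (c + smult r d) x" if r: "r \<in> S" "X r = x" for r
      proof -
        have "repeated_root (P (\<nu>(k := r))) (X r)"
          by (rule X[OF r(1)]) (simp_all add: \<nu>)
        then show ?thesis by (simp only: cd r(2))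
      qed
      have "repeated_root (c + smult (\<nu> k) d) x"
        by (rule repeated_root_pencil_extend[OF rep[OF t(1,2)] rep[OF s] t(3)])
      then show ?thesis by (simp only: cd[symmetric] fun_upd_triv)
    qed
    then show ?case by (intro exI[of _ x]) simp
  qed
  obtain m where m: "m \<in> S" using S by (metis ex_in_conv finite.emptyI)
  have "\<exists>x. \<forall>\<nu>. (\<forall>i\<ge>n. \<nu> i = m) \<longrightarrow> repeated_root (P \<nu>) x"
    using claim[of n "\<lambda>_. m"] m by simp
  then obtain x where x: "\<forall>\<nu>. (\<forall>i\<ge>n. \<nu> i = m) \<longrightarrow> repeated_root (P \<nu>) x"
    by (rule exE)
  \<comment> \<open>\<open>mat_diag n\<close> ignores indices from \<open>n\<close> on, so resetting
    them to \<open>m\<close> loses nothing.\<close>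
  have "repeated_root (P \<nu>) x" for \<nu>
  proof -
    have "mat_diag n (\<lambda>i. if i < n then \<nu> i else m) = mat_diag n \<nu>"
      unfolding mat_diag_def by (intro eq_matI) auto
    then have "P (\<lambda>i. if i < n then \<nu> i else m) = P \<nu>"
      unfolding P_def by simp
    then show ?thesis using spec[OF x, of "\<lambda>i. if i < n then \<nu> i else m"] by simp
  qed
  then show ?thesis unfolding P_def by (intro exI[of _ x]) simp
qed

lemma ex_diag_mult_no_repeated_eigenvalue:
  fixes W :: "complex mat"
  assumes W: "W \<in> carrier_mat n n" and W': "W' \<in> carrier_mat n n" "W' * W = 1\<^sub>m n" and S: "infinite S"
  obtains \<mu> where "\<And>i. \<mu> i \<in> S" "\<not> repeated_eigenvalue (mat_diag n \<mu> * W)"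
proof (rule ccontr)
  note witness = that
  assume "\<not> thesis"
  then have neg: "repeated_eigenvalue (mat_diag n \<mu> * W)" if "\<forall>i. \<mu> i \<in> S" for \<mu>
    using witness[of \<mu>] that by metis
  have carr: "mat_diag n \<mu> * W \<in> carrier_mat n n" for \<mu>
    by (rule mult_carrier_mat[OF mat_diag_dim W])
  have ne: "char_poly (mat_diag n \<mu> * W) \<noteq> 0" for \<mu>
    using degree_monic_char_poly[OF carr[of \<mu>]] by auto
  obtain x where x: "\<And>\<mu>. repeated_root (char_poly (mat_diag n \<mu> * W)) x"
    using common_repeated_root[OF W S] neg ne
    unfolding repeated_eigenvalue_def by (metis repeated_root_iff_order)
  have ev: "eigenvalue (mat_diag n \<mu> * W) x" for \<mu>
    using x[of \<mu>] eigenvalue_root_char_poly[OF carr] by (simp add: repeated_root_def)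
  have "mat_diag n (\<lambda>_. 0) * W = 0\<^sub>m n n"
    unfolding mat_diag_mult_left[OF W] by auto
  then have "eigenvalue (0\<^sub>m n n) x" using ev[of "\<lambda>_. 0"] by simp
  then obtain v where "v \<in> carrier_vec n" "v \<noteq> 0\<^sub>v n" "0\<^sub>m n n *\<^sub>v v = x \<cdot>\<^sub>v v"
    unfolding eigenvalue_def eigenvector_def by auto
  then have x0: "x = 0"
    by (auto simp: vec_eq_iff)
  have "eigenvalue W 0" using ev[of "\<lambda>_. 1"] W x0 by simp
  then obtain w where w: "w \<in> carrier_vec n" "w \<noteq> 0\<^sub>v n" "W *\<^sub>v w = 0 \<cdot>\<^sub>v w"
    unfolding eigenvalue_def eigenvector_def using W by auto
  have "w = (W' * W) *\<^sub>v w" using w W'(2) by simp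
  also have "\<dots> = W' *\<^sub>v (W *\<^sub>v w)" by (rule assoc_mult_mat_vec[OF W'(1) W w(1)])
  also have "\<dots> = 0\<^sub>v n" unfolding w(3) using W'(1) w(1) by (intro eq_vecI) (auto simp: scalar_prod_def)
  finally show False using w(2) by simp
qed

section \<open>Singular value decomposition\<close>

lemma mat_adjoint_index [simp]:
  "i < dim_col A \<Longrightarrow> j < dim_row A \<Longrightarrow> mat_adjoint A $$ (i, j) = conjugate (A $$ (j, i))"
  by (simp add: mat_adjoint_def mat_of_rows_def)

lemma mat_adjoint_dim [simp]: "dim_row (mat_adjoint A) = dim_col A" "dim_col (mat_adjoint A) = dim_row A"
  by (simp_all add: mat_adjoint_def)

lemma mat_adjoint_carrier [simp]: "A \<in> carrier_mat m n \<Longrightarrow> mat_adjoint A \<in> carrier_mat n m"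
  by (intro carrier_matI) auto

lemma mult_carrier_square_mat [simp]:
  "A \<in> carrier_mat n n \<Longrightarrow> B \<in> carrier_mat n n \<Longrightarrow> A * B \<in> carrier_mat n n"
  by (rule mult_carrier_mat)

lemma mat_adjoint_adjoint [simp]: "mat_adjoint (mat_adjoint A) = A"
  by (intro eq_matI) auto

lemma mat_adjoint_mult:
  fixes A B :: "complex mat"
  assumes "A \<in> carrier_mat l m" "B \<in> carrier_mat m n"
  shows "mat_adjoint (A * B) = mat_adjoint B * mat_adjoint A"
  using assms by (intro eq_matI) (auto simp: scalar_prod_def mult.commute)

lemma det_mat_adjoint:
  fixes A :: "complex mat"
  assumes "A \<in> carrier_mat n n"
  shows "Determinant.det (mat_adjoint A) = cnj (Determinant.det A)"
proof -
  have h: "comm_ring_hom cnj" by unfold_locales auto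
  have "mat_adjoint A = transpose_mat (map_mat cnj A)"
    by (intro eq_matI) auto
  then show ?thesis
    using assms comm_ring_hom.hom_det[OF h] by (simp add: Determinant.det_transpose[of _ n])
qed

lemma unitary_matI:
  assumes "U \<in> carrier_mat n n" "mat_adjoint U * U = 1\<^sub>m n"
  shows "unitary_mat n U"
  unfolding unitary_mat_def
  using assms mat_mult_left_right_inverse[of "mat_adjoint U" n U] by auto

lemma unitary_mat_mult:
  assumes "unitary_mat n U" "unitary_mat n V"
  shows "unitary_mat n (U * V)"
proof (rule unitary_matI)
  have c: "U \<in> carrier_mat n n" "V \<in> carrier_mat n n" using assms by (auto simp: unitary_mat_def)
  show "U * V \<in> carrier_mat n n" using c by simp
  have "mat_adjoint (U * V) * (U * V) = mat_adjoint V * ((mat_adjoint U * U) * V)"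
    using c by (simp add: mat_adjoint_mult[OF c] assoc_mult_mat[of _ n n _ n _ n])
  then show "mat_adjoint (U * V) * (U * V) = 1\<^sub>m n"
    using assms c by (simp add: unitary_mat_def)
qed

text \<open>The Gram matrix is diagonal with positive entries \<open>r i\<close>, the squared column
  norms; \<open>d i\<close> is the reciprocal norm. That \<open>d i\<close> is nonzero keeps each
  new column a nonzero multiple of the old one.\<close>

lemma corthogonal_mat_normalize:
  fixes W :: "complex mat"
  assumes W: "W \<in> carrier_mat n n" and orth: "corthogonal_mat W"
  obtains d where "\<And>i. i < n \<Longrightarrow> d i \<noteq> 0" "unitary_mat n (W * mat_diag n d)"
proof -
  define r where "r i = (\<Sum>k<n. (cmod (W $$ (k, i)))\<^sup>2)" for i
  define d where "d i = complex_of_real (1 / sqrt (r i))" for i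
  have gram: "(mat_adjoint W * W) $$ (i, j) = (\<Sum>k<n. cnj (W $$ (k, i)) * W $$ (k, j))"
    if "i < n" "j < n" for i j
    using W that by (auto simp: scalar_prod_def atLeast0LessThan)
  have diag: "(mat_adjoint W * W) $$ (i, i) = complex_of_real (r i)" if "i < n" for i
    unfolding gram[OF that that] r_def of_real_sum
    by (intro sum.cong refl) (simp only: complex_norm_square mult.commute)
  have r0: "r i > 0" if "i < n" for i
  proof -
    have "r i \<noteq> 0" using orth that W diag[OF that] unfolding corthogonal_mat_def Let_def by auto
    moreover have "r i \<ge> 0" unfolding r_def by (intro sum_nonneg) auto
    ultimately show ?thesis by simp
  qed
  have off: "(mat_adjoint W * W) $$ (i, j) = 0" if "i < n" "j < n" "i \<noteq> j" for i j
    using orth that W unfolding corthogonal_mat_def Let_def diagonal_mat_def by auto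
  let ?U = "W * mat_diag n d"
  have U: "?U = mat n n (\<lambda>(i, j). W $$ (i, j) * d j)" by (rule mat_diag_mult_right[OF W])
  have "mat_adjoint ?U * ?U = 1\<^sub>m n"
  proof (rule eq_matI)
    fix i j assume "i < dim_row (1\<^sub>m n :: complex mat)" "j < dim_col (1\<^sub>m n :: complex mat)"
    then have ij: "i < n" "j < n" by auto
    have "(mat_adjoint ?U * ?U) $$ (i, j) = (\<Sum>k<n. cnj (W $$ (k, i) * d i) * (W $$ (k, j) * d j))"
      unfolding U using ij by (auto simp: scalar_prod_def atLeast0LessThan)
    also have "\<dots> = d i * d j * (mat_adjoint W * W) $$ (i, j)"
      unfolding gram[OF ij] sum_distrib_left
      by (intro sum.cong refl) (simp add: d_def)
    also have "\<dots> = 1\<^sub>m n $$ (i, j)"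
    proof (cases "i = j")
      case True
      have "1 / sqrt (r j) * (1 / sqrt (r j)) * r j = 1"
        using r0[OF ij(2)] by (simp add: field_simps)
      then show ?thesis
        using True ij diag[OF ij(2)] unfolding d_def by (simp flip: of_real_mult del: of_real_divide)
    next
      case False
      then show ?thesis using ij off[OF ij] by simp
    qed
    finally show "(mat_adjoint ?U * ?U) $$ (i, j) = 1\<^sub>m n $$ (i, j)" .
  qed (use W in \<open>auto simp: mat_diag_def\<close>)
  then have "unitary_mat n ?U"
    using W by (intro unitary_matI) (auto simp: U)
  moreover have "d i \<noteq> 0" if "i < n" for i using r0[OF that] by (simp add: d_def)
  ultimately show ?thesis using that by metis
qed

text \<open>Complete \<open>v\<close> to a basis and apply Gram-Schmidt, which keeps the first
  vector; normalization then only rescales it.\<close>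

lemma ex_unitary_mat_first_col:
  fixes v :: "complex vec"
  assumes v: "v \<in> carrier_vec n" "v \<noteq> 0\<^sub>v n"
  obtains U c where "unitary_mat n U" "c \<noteq> 0" "col U 0 = c \<cdot>\<^sub>v v"
proof -
  interpret cof_vec_space n "TYPE(complex)" .
  have n: "n > 0" using v by (cases n) auto
  define ws where "ws = gram_schmidt n (basis_completion v)"
  note bc = basis_completion[OF v]
  have len: "length (basis_completion v) = n"
    using bc(6) by simp
  have ws: "corthogonal ws" "set ws \<subseteq> carrier_vec n" "length ws = n"
    using gram_schmidt_result[OF bc(2) bc(4) bc(5) ws_def] len by auto
  have "basis_completion v = v # tl (basis_completion v)"
    using bc(7) len n by (cases "basis_completion v") auto
  then have "hd ws = v" unfolding ws_def using gram_schmidt_hd[OF v(1)] by metis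
  then have ws0: "ws ! 0 = v" using ws(3) n by (cases ws) auto
  define W where "W = mat_of_cols n ws"
  have W: "W \<in> carrier_mat n n" unfolding W_def using ws by auto
  have "corthogonal_mat W" unfolding W_def using ws by (intro orthogonal_mat_of_cols)
  then obtain d where d: "\<And>i. i < n \<Longrightarrow> d i \<noteq> 0" "unitary_mat n (W * mat_diag n d)"
    using corthogonal_mat_normalize[OF W] by metis
  have "col (W * mat_diag n d) 0 = d 0 \<cdot>\<^sub>v v"
    unfolding mat_diag_mult_right[OF W] using n v(1) ws ws0
    by (intro eq_vecI) (auto simp: W_def mat_of_cols_index)
  then show ?thesis using that[OF d(2) d(1)[OF n]] by blast
qed

text \<open>The direct sum of a scalar and a matrix, which carries the deflation step of the
  singular value decomposition.\<close>

definition block_diag1 :: "complex \<Rightarrow> complex mat \<Rightarrow> complex mat" where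
  "block_diag1 c A = four_block_mat (mat 1 1 (\<lambda>_. c)) (0\<^sub>m 1 (dim_col A)) (0\<^sub>m (dim_row A) 1) A"

lemma block_diag1_carrier [simp]:
  "A \<in> carrier_mat n m \<Longrightarrow> block_diag1 c A \<in> carrier_mat (Suc n) (Suc m)"
  unfolding block_diag1_def by auto

lemma block_diag1_mult:
  assumes A: "A \<in> carrier_mat n n" and B: "B \<in> carrier_mat n n"
  shows "block_diag1 c A * block_diag1 d B = block_diag1 (c * d) (A * B)"
proof -
  have "block_diag1 c A * block_diag1 d B = four_block_mat
     (mat 1 1 (\<lambda>_. c) * mat 1 1 (\<lambda>_. d) + 0\<^sub>m 1 n * 0\<^sub>m n 1)
     (mat 1 1 (\<lambda>_. c) * 0\<^sub>m 1 n + 0\<^sub>m 1 n * B)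
     (0\<^sub>m n 1 * mat 1 1 (\<lambda>_. d) + A * 0\<^sub>m n 1)
     (0\<^sub>m n 1 * 0\<^sub>m 1 n + A * B)"
    unfolding block_diag1_def carrier_matD[OF A] carrier_matD[OF B]
    by (rule mult_four_block_mat) (use A B in auto)
  also have "mat 1 1 (\<lambda>_. c) * mat 1 1 (\<lambda>_. d) + 0\<^sub>m 1 n * 0\<^sub>m n 1 = mat 1 1 (\<lambda>_. c * d)"
    by (intro eq_matI) (auto simp: scalar_prod_def)
  also have "mat 1 1 (\<lambda>_. c) * 0\<^sub>m 1 n + 0\<^sub>m 1 n * B = 0\<^sub>m 1 n"
    using B by (intro eq_matI) (auto simp: scalar_prod_def)
  also have "0\<^sub>m n 1 * mat 1 1 (\<lambda>_. d) + A * 0\<^sub>m n 1 = 0\<^sub>m n 1"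
    using A by (intro eq_matI) (auto simp: scalar_prod_def)
  also have "0\<^sub>m n 1 * 0\<^sub>m 1 n + A * B = A * B"
    using A B by (intro eq_matI) (auto simp: scalar_prod_def)
  finally show ?thesis using A B by (simp add: block_diag1_def)
qed

lemma mat_adjoint_block_diag1: "mat_adjoint (block_diag1 c A) = block_diag1 (cnj c) (mat_adjoint A)"
  unfolding block_diag1_def by (intro eq_matI) (auto simp: not_less_eq)

lemma one_mat_block_diag1: "block_diag1 1 (1\<^sub>m n) = 1\<^sub>m (Suc n)"
  unfolding block_diag1_def by (intro eq_matI) auto

lemma mat_diag_Suc: "mat_diag (Suc n) s = block_diag1 (s 0) (mat_diag n (\<lambda>i. s (Suc i)))"
  unfolding block_diag1_def mat_diag_def
  by (intro eq_matI) (auto simp: not_less_eq)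

lemma unitary_block_diag1:
  assumes "unitary_mat n U"
  shows "unitary_mat (Suc n) (block_diag1 1 U)"
proof (rule unitary_matI)
  have U: "U \<in> carrier_mat n n" using assms by (simp add: unitary_mat_def)
  then show "block_diag1 1 U \<in> carrier_mat (Suc n) (Suc n)" by simp
  show "mat_adjoint (block_diag1 1 U) * block_diag1 1 U = 1\<^sub>m (Suc n)"
    using assms block_diag1_mult[OF mat_adjoint_carrier[OF U] U]
    by (simp add: mat_adjoint_block_diag1 unitary_mat_def one_mat_block_diag1)
qed

text \<open>If \<open>T\<close> is singular, so is its adjoint, and kernel vectors work with both
  scalars 0. Otherwise take an eigenvector \<open>v\<close> of \<open>mat_adjoint T * T\<close> and
  \<open>u = T *\<^sub>v v\<close>, which is nonzero.\<close>

lemma ex_singular_vector_pair: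
  fixes T :: "complex mat"
  assumes T: "T \<in> carrier_mat n n" and n: "n > 0"
  obtains u v \<alpha> \<beta> where
    "u \<in> carrier_vec n" "u \<noteq> 0\<^sub>v n" "v \<in> carrier_vec n" "v \<noteq> 0\<^sub>v n"
    "T *\<^sub>v v = \<alpha> \<cdot>\<^sub>v u" "mat_adjoint T *\<^sub>v u = \<beta> \<cdot>\<^sub>v v"
proof (cases "Determinant.det T = 0")
  case True
  obtain v where v: "v \<in> carrier_vec n" "v \<noteq> 0\<^sub>v n" "T *\<^sub>v v = 0\<^sub>v n"
    using True det_0_iff_vec_prod_zero[OF T] by auto
  have "Determinant.det (mat_adjoint T) = 0" using True det_mat_adjoint[OF T] by simp
  then obtain u where u: "u \<in> carrier_vec n" "u \<noteq> 0\<^sub>v n" "mat_adjoint T *\<^sub>v u = 0\<^sub>v n"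
    using det_0_iff_vec_prod_zero[OF mat_adjoint_carrier[OF T]] by auto
  show ?thesis
    using that[of u v 0 0] u v by (auto simp: smult_vec_def zero_vec_def)
next
  case False
  have "mat_adjoint T * T \<in> carrier_mat n n" using T by simp
  from spectrum_non_empty[OF this] n obtain \<beta> v where
    v: "v \<in> carrier_vec n" "v \<noteq> 0\<^sub>v n" "(mat_adjoint T * T) *\<^sub>v v = \<beta> \<cdot>\<^sub>v v"
    using T unfolding spectrum_def eigenvalue_def eigenvector_def by auto
  have "T *\<^sub>v v \<noteq> 0\<^sub>v n"
    using False v det_0_iff_vec_prod_zero[OF T] by auto
  moreover have "mat_adjoint T *\<^sub>v (T *\<^sub>v v) = \<beta> \<cdot>\<^sub>v v"
    using v(3) assoc_mult_mat_vec[OF mat_adjoint_carrier[OF T] T v(1)] by simp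
  ultimately show ?thesis
    using that[of "T *\<^sub>v v" v 1 \<beta>] v T by auto
qed

text \<open>The first column of \<open>T * V\<close> is a multiple of the first column of
  \<open>U\<close>, which is orthogonal to every other column of \<open>U\<close>.\<close>

lemma unitary_conj_first_col:
  fixes T :: "complex mat"
  assumes T: "T \<in> carrier_mat n n" and U: "unitary_mat n U" and V: "V \<in> carrier_mat n n"
    and u: "u \<in> carrier_vec n" and v: "v \<in> carrier_vec n"
    and cols: "col U 0 = c \<cdot>\<^sub>v u" "c \<noteq> 0" "col V 0 = d \<cdot>\<^sub>v v"
    and Tv: "T *\<^sub>v v = \<alpha> \<cdot>\<^sub>v u" and i: "0 < i" "i < n"
  shows "(mat_adjoint U * (T * V)) $$ (i, 0) = 0"
proof -
  have U': "U \<in> carrier_mat n n" "mat_adjoint U * U = 1\<^sub>m n" using U by (auto simp: unitary_mat_def)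
  have n: "0 < n" using i by simp
  have "col (T * V) 0 = T *\<^sub>v col V 0" by (rule col_mult2[OF T V n])
  also have "\<dots> = (d * \<alpha> / c) \<cdot>\<^sub>v col U 0"
    using T v u Tv cols(2) by (simp add: cols(1,3) mult_mat_vec[of _ n n] smult_smult_assoc)
  finally have TV: "col (T * V) 0 = (d * \<alpha> / c) \<cdot>\<^sub>v col U 0" .
  have "(mat_adjoint U * (T * V)) $$ (i, 0) = row (mat_adjoint U) i \<bullet> col (T * V) 0"
    using T U' V n i by simp
  also have "\<dots> = (d * \<alpha> / c) * (row (mat_adjoint U) i \<bullet> col U 0)"
    unfolding TV using U'(1) n i by simp
  also have "row (mat_adjoint U) i \<bullet> col U 0 = (mat_adjoint U * U) $$ (i, 0)"
    using U'(1) n i by simp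
  finally show ?thesis using U'(2) n i by simp
qed

text \<open>Deflation: bases starting with a singular vector pair split off a 1 x 1 block, and
  induction treats the rest. The \<open>s i\<close> are complex, as phased singular values may
  be.\<close>

theorem singular_value_decomposition:
  fixes T :: "complex mat"
  assumes "T \<in> carrier_mat n n"
  shows "\<exists>U V s. unitary_mat n U \<and> unitary_mat n V \<and> T = U * mat_diag n s * mat_adjoint V"
  using assms
proof (induction n arbitrary: T)
  case 0
  have "unitary_mat 0 (1\<^sub>m 0)" by (intro unitary_matI) auto
  moreover have "T = 1\<^sub>m 0 * mat_diag 0 s * mat_adjoint (1\<^sub>m 0)" for s
    using 0 by (intro eq_matI) auto
  ultimately show ?case by blast
next
  case (Suc n)
  let ?n = "Suc n"
  obtain u v \<alpha> \<beta> where uv: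
    "u \<in> carrier_vec ?n" "u \<noteq> 0\<^sub>v ?n" "v \<in> carrier_vec ?n" "v \<noteq> 0\<^sub>v ?n"
    "T *\<^sub>v v = \<alpha> \<cdot>\<^sub>v u" "mat_adjoint T *\<^sub>v u = \<beta> \<cdot>\<^sub>v v"
    using ex_singular_vector_pair[OF Suc.prems] by blast
  obtain U c where U: "unitary_mat ?n U" "c \<noteq> 0" "col U 0 = c \<cdot>\<^sub>v u"
    using ex_unitary_mat_first_col[OF uv(1,2)] by blast
  obtain V d where V: "unitary_mat ?n V" "d \<noteq> 0" "col V 0 = d \<cdot>\<^sub>v v"
    using ex_unitary_mat_first_col[OF uv(3,4)] by blast
  have [simp]: "U \<in> carrier_mat ?n ?n" "V \<in> carrier_mat ?n ?n" "T \<in> carrier_mat ?n ?n"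
    using U V Suc.prems by (auto simp: unitary_mat_def)
  note assoc = assoc_mult_mat[of _ ?n ?n _ ?n _ ?n]
  define M where "M = mat_adjoint U * (T * V)"
  have M [simp]: "M \<in> carrier_mat ?n ?n" unfolding M_def by simp
  have adjM: "mat_adjoint M = mat_adjoint V * (mat_adjoint T * U)"
    unfolding M_def by (simp add: mat_adjoint_mult[of _ ?n ?n _ ?n] assoc)
  have col0: "M $$ (i, 0) = 0" if "0 < i" "i < ?n" for i
    unfolding M_def
    using unitary_conj_first_col[OF _ U(1) _ uv(1,3) U(3,2) V(3) uv(5) that] by simp
  \<comment> \<open>The first row of \<open>M\<close> is the conjugate of the first column of its
    adjoint, where the roles of \<open>U\<close> and \<open>V\<close> are exchanged.\<close>
  have row0: "M $$ (0, i) = 0" if "0 < i" "i < ?n" for i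
  proof -
    have "mat_adjoint M $$ (i, 0) = 0"
      unfolding adjM
      using unitary_conj_first_col[OF _ V(1) _ uv(3,1) V(3,2) U(3) uv(6) that] by simp
    then show ?thesis using that M by (metis carrier_matD complex_cnj_zero_iff conjugate_complex_def mat_adjoint_index zero_less_Suc)
  qed
  define N where "N = mat n n (\<lambda>(i, j). M $$ (Suc i, Suc j))"
  have N [simp]: "N \<in> carrier_mat n n" unfolding N_def by simp
  have MN: "M = block_diag1 (M $$ (0, 0)) N"
  proof (rule eq_matI)
    fix i j assume "i < dim_row (block_diag1 (M $$ (0, 0)) N)" "j < dim_col (block_diag1 (M $$ (0, 0)) N)"
    then have ij: "i < ?n" "j < ?n" by (auto simp: block_diag1_def N_def)
    then show "M $$ (i, j) = block_diag1 (M $$ (0, 0)) N $$ (i, j)"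
      by (cases i; cases j) (auto simp: block_diag1_def N_def col0 row0)
  qed (auto simp: block_diag1_def N_def carrier_matD[OF M])
  obtain U' V' s where IH: "unitary_mat n U'" "unitary_mat n V'" "N = U' * mat_diag n s * mat_adjoint V'"
    using Suc.IH[OF N] by blast
  have [simp]: "U' \<in> carrier_mat n n" "V' \<in> carrier_mat n n" using IH by (auto simp: unitary_mat_def)
  define D where "D = mat_diag ?n (case_nat (M $$ (0, 0)) s)"
  let ?U = "block_diag1 1 U'" and ?V = "block_diag1 1 V'"
  have [simp]: "D \<in> carrier_mat ?n ?n" unfolding D_def by simp
  have MD: "M = ?U * D * mat_adjoint ?V"
    unfolding D_def mat_diag_Suc mat_adjoint_block_diag1
    by (subst MN) (simp add: block_diag1_mult[of _ n] IH(3))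
  have UU: "U * mat_adjoint U = 1\<^sub>m ?n" "V * mat_adjoint V = 1\<^sub>m ?n"
    using U V by (auto simp: unitary_mat_def)
  have "T = (U * mat_adjoint U) * T * (V * mat_adjoint V)" unfolding UU left_mult_one_mat[OF Suc.prems] right_mult_one_mat[OF Suc.prems] ..
  also have "\<dots> = U * M * mat_adjoint V" unfolding M_def by (simp add: assoc)
  also have "\<dots> = (U * ?U) * D * mat_adjoint (V * ?V)"
    unfolding MD by (simp add: mat_adjoint_mult[of _ ?n ?n _ ?n] assoc)
  finally show ?case
    using unitary_mat_mult[OF U(1) unitary_block_diag1[OF IH(1)]]
      unitary_mat_mult[OF V(1) unitary_block_diag1[OF IH(2)]] unfolding D_def by blast
qed

section \<open>The operator norm bounds the singular values\<close>

lemma l2_norm_le_sum_cmod: "l2_norm v \<le> (\<Sum>i<dim_vec v. cmod (v $ i))"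
  unfolding l2_norm_def by (intro L2_set_le_sum) auto

lemma cmod_index_le_l2_norm:
  assumes "i < dim_vec v"
  shows "cmod (v $ i) \<le> l2_norm v"
  unfolding l2_norm_def using assms by (intro member_le_L2_set) auto

text \<open>The supremum is an upper bound only for a set bounded above. Coordinates of vectors in
  the unit ball have modulus at most 1, so the sum of the moduli of all entries of \<open>A\<close>
  is a bound.\<close>

lemma l2_norm_mult_mat_vec_le_op_norm:
  assumes v: "v \<in> carrier_vec (dim_col A)" "l2_norm v \<le> 1"
  shows "l2_norm (A *\<^sub>v v) \<le> op_norm A"
proof -
  have "bdd_above ((\<lambda>v. l2_norm (A *\<^sub>v v)) ` {v \<in> carrier_vec (dim_col A). l2_norm v \<le> 1})"
  proof (rule bdd_aboveI2)
    fix w assume "w \<in> {v \<in> carrier_vec (dim_col A). l2_norm v \<le> 1}"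
    then have w: "dim_vec w = dim_col A" "l2_norm w \<le> 1" by auto
    have "l2_norm (A *\<^sub>v w) \<le> (\<Sum>i<dim_row A. cmod ((A *\<^sub>v w) $ i))"
      using l2_norm_le_sum_cmod[of "A *\<^sub>v w"] by simp
    also have "\<dots> \<le> (\<Sum>i<dim_row A. \<Sum>j<dim_col A. cmod (A $$ (i, j)))"
    proof (intro sum_mono)
      fix i assume i: "i \<in> {..<dim_row A}"
      have "cmod ((A *\<^sub>v w) $ i) = cmod (\<Sum>j<dim_col A. A $$ (i, j) * w $ j)"
        using i w by (simp add: scalar_prod_def atLeast0LessThan)
      also have "\<dots> \<le> (\<Sum>j<dim_col A. cmod (A $$ (i, j)) * cmod (w $ j))"
        by (rule order_trans[OF norm_sum]) (simp add: norm_mult)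
      also have "\<dots> \<le> (\<Sum>j<dim_col A. cmod (A $$ (i, j)))"
      proof (intro sum_mono mult_left_le norm_ge_zero)
        fix j assume "j \<in> {..<dim_col A}"
        then show "cmod (w $ j) \<le> 1" using cmod_index_le_l2_norm[of j w] w by simp
      qed
      finally show "cmod ((A *\<^sub>v w) $ i) \<le> (\<Sum>j<dim_col A. cmod (A $$ (i, j)))" .
    qed
    finally show "l2_norm (A *\<^sub>v w) \<le> (\<Sum>i<dim_row A. \<Sum>j<dim_col A. cmod (A $$ (i, j)))" .
  qed
  then show ?thesis unfolding op_norm_def using v by (intro cSUP_upper) auto
qed

lemma l2_norm_unitary_col:
  assumes "unitary_mat n U" "i < n"
  shows "l2_norm (col U i) = 1"
proof -
  have U: "U \<in> carrier_mat n n" "mat_adjoint U * U = 1\<^sub>m n" using assms by (auto simp: unitary_mat_def)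
  have "complex_of_real (\<Sum>k<n. (cmod (U $$ (k, i)))\<^sup>2) = (\<Sum>k<n. cnj (U $$ (k, i)) * U $$ (k, i))"
    unfolding of_real_sum by (intro sum.cong refl) (simp only: complex_norm_square mult.commute)
  also have "\<dots> = (mat_adjoint U * U) $$ (i, i)"
    using U(1) assms(2) by (auto simp: scalar_prod_def atLeast0LessThan)
  also have "\<dots> = complex_of_real 1" using U(2) assms(2) by simp
  finally have "(\<Sum>k<n. (cmod (U $$ (k, i)))\<^sup>2) = 1" by (simp only: of_real_eq_iff)
  then show ?thesis using U(1) assms(2) by (simp add: l2_norm_def L2_set_def)
qed

text \<open>\<open>T\<close> sends column \<open>i\<close> of \<open>V\<close> to \<open>s i\<close>
  times column \<open>i\<close> of \<open>U\<close>, and both columns are unit vectors.\<close>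

lemma cmod_singular_value_le_op_norm:
  assumes U: "unitary_mat n U" and V: "unitary_mat n V"
    and T: "T = U * mat_diag n s * mat_adjoint V" and i: "i < n"
  shows "cmod (s i) \<le> op_norm T"
proof -
  have c [simp]: "U \<in> carrier_mat n n" "V \<in> carrier_mat n n" "mat_adjoint V * V = 1\<^sub>m n"
    using U V by (auto simp: unitary_mat_def)
  have T': "T \<in> carrier_mat n n" unfolding T by simp
  have "T * V = U * mat_diag n s" unfolding T by (simp add: assoc_mult_mat[of _ n n _ n _ n] right_mult_one_mat[of _ n n])
  then have TV: "T * V = mat n n (\<lambda>(i, j). U $$ (i, j) * s j)" by (simp add: mat_diag_mult_right[of _ n n])
  have "T *\<^sub>v col V i = col (T * V) i" by (rule col_mult2[OF T' c(2) i, symmetric])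
  also have "\<dots> = s i \<cdot>\<^sub>v col U i" unfolding TV using i by (intro eq_vecI) (auto simp: carrier_matD[OF c(1)])
  finally have "l2_norm (T *\<^sub>v col V i) = l2_norm (s i \<cdot>\<^sub>v col U i)" by simp
  also have "\<dots> = cmod (s i) * l2_norm (col U i)"
    unfolding l2_norm_def L2_set_right_distrib[OF norm_ge_zero] by (intro L2_set_cong) (auto simp: norm_mult)
  finally have "cmod (s i) = l2_norm (T *\<^sub>v col V i)" using l2_norm_unitary_col[OF U i] by simp
  also have "\<dots> \<le> op_norm T"
    using T' l2_norm_unitary_col[OF V i]
    by (intro l2_norm_mult_mat_vec_le_op_norm carrier_vecI) (auto simp: carrier_matD[OF c(2)])
  finally show ?thesis .
qed

section \<open>Fractured Nelson dilations\<close>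

text \<open>The resultant vanishes exactly when the gcd is nonconstant, which over the complex
  numbers means that it has a root.\<close>

lemma resultant_pderiv_eq_0_iff:
  fixes p :: "complex poly"
  assumes "p \<noteq> 0"
  shows "resultant p (pderiv p) = 0 \<longleftrightarrow> (\<exists>x. repeated_root p x)"
proof -
  let ?g = "gcd p (pderiv p)"
  have "degree ?g \<noteq> 0 \<longleftrightarrow> (\<exists>x. poly ?g x = 0)"
    using assms by (metis constant_degree degree_eq_zeroE fundamental_theorem_of_algebra gcd_eq_0_iff
      mult_zero_right add_0_right pCons_0_0 poly_pCons poly_0)
  also have "\<dots> \<longleftrightarrow> (\<exists>x. repeated_root p x)"
    unfolding repeated_root_def poly_eq_0_iff_dvd gcd_greatest_iff[symmetric] by simp
  finally show ?thesis by (simp add: resultant_0_gcd)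
qed

text \<open>The discriminant, taken as the resultant \<open>R\<close> of the characteristic
  polynomial and its derivative, is a polynomial in \<open>z\<close>; it is nonzero at
  \<open>c\<close>, so it has finitely many zeros.\<close>

lemma finite_repeated_eigenvalue_poly_mat:
  fixes M :: "complex poly mat"
  assumes M: "M \<in> carrier_mat n n"
    and c: "\<not> repeated_eigenvalue (map_mat (\<lambda>p. poly p c) M)"
  shows "finite {z. repeated_eigenvalue (map_mat (\<lambda>p. poly p z) M)}"
proof -
  define R where "R = resultant (char_poly M) (pderiv (char_poly M))"
  have dM: "degree (char_poly M) = n" "coeff (char_poly M) n = 1"
    using degree_monic_char_poly[OF M] by auto
  have R: "poly R z = 0 \<longleftrightarrow> repeated_eigenvalue (map_mat (\<lambda>p. poly p z) M)" for z
  proof -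
    have h: "comm_ring_hom (\<lambda>p. poly p z)" by unfold_locales auto
    have cp: "map_poly (\<lambda>p. poly p z) (char_poly M) = char_poly (map_mat (\<lambda>p. poly p z) M)" (is "_ = ?q")
      using comm_ring_hom.char_poly_hom[OF h M] by simp
    have carr: "map_mat (\<lambda>p. poly p z) M \<in> carrier_mat n n" using M by auto
    have dq: "degree ?q = n" "coeff ?q n = 1" using degree_monic_char_poly[OF carr] by auto
    have pd: "map_poly (\<lambda>p. poly p z) (pderiv (char_poly M)) = pderiv ?q"
      unfolding cp[symmetric] by (intro poly_eqI) (simp add: coeff_map_poly coeff_pderiv)
    \<comment> \<open>Evaluation commutes with the resultant because no degree drops: the
      characteristic polynomial is monic and its derivative has degree \<open>n - 1\<close> before
      and after.\<close>
    have "resultant ?q (pderiv ?q) = poly R z"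
      unfolding R_def cp[symmetric] pd[symmetric, unfolded cp[symmetric]]
      by (rule comm_ring_hom.resultant_map_poly[OF h]) (simp_all add: cp pd dq dM degree_pderiv)
    moreover have "?q \<noteq> 0" using dq by auto
    ultimately show ?thesis
      unfolding repeated_eigenvalue_def using resultant_pderiv_eq_0_iff repeated_root_iff_order by metis
  qed
  have "poly R c \<noteq> 0" using c by (simp only: R not_False_eq_True)
  then have "R \<noteq> 0" by auto
  then show ?thesis unfolding R[symmetric] by (rule poly_roots_finite)
qed

section \<open>Disk automorphisms and reduction to polynomial entries\<close>

lemma repeated_eigenvalue_smult_iff:
  assumes "A \<in> carrier_mat n n" "k \<noteq> 0"
  shows "repeated_eigenvalue (k \<cdot>\<^sub>m A) \<longleftrightarrow> repeated_eigenvalue A"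
proof -
  have "(\<exists>x. 2 \<le> Polynomial.order (x / k) (char_poly A)) \<longleftrightarrow> (\<exists>y. 2 \<le> Polynomial.order y (char_poly A))"
  proof
    assume "\<exists>y. 2 \<le> Polynomial.order y (char_poly A)"
    then obtain y where "2 \<le> Polynomial.order y (char_poly A)" by (rule exE)
    then show "\<exists>x. 2 \<le> Polynomial.order (x / k) (char_poly A)"
      using assms(2) by (intro exI[of _ "y * k"]) simp
  qed (rule exE, assumption, rule exI)
  then show ?thesis
    unfolding repeated_eigenvalue_def order_char_poly_smult[OF assms] .
qed

text \<open>\<open>l\<close> is the preimage of \<open>m\<close> under the automorphism
  \<open>w \<mapsto> (w + s) / (1 + cnj s * w)\<close>. It is unimodular because
  \<open>m - s = m * cnj (1 - cnj s * m)\<close> on the circle.\<close>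

lemma disk_automorphism_interpolation:
  assumes s: "cmod s < 1" and m: "cmod m = 1"
  obtains l where "cmod l = 1" "1 + cnj s * l \<noteq> 0" "(l + s) / (1 + cnj s * l) = m"
proof -
  have ne: "1 - cnj s * m \<noteq> 0"
  proof
    assume "1 - cnj s * m = 0"
    then have "cmod (cnj s * m) = 1" by simp
    then show False using s m by (simp add: norm_mult)
  qed
  have mm: "m * cnj m = 1" using m by (metis complex_norm_square of_real_1 one_power2)
  define l where "l = (m - s) / (1 - cnj s * m)"
  have "m - s = m * cnj (1 - cnj s * m)" using mm by (simp add: algebra_simps)
  then have "cmod (m - s) = cmod (1 - cnj s * m)"
    using m by (metis complex_mod_cnj mult_1 norm_mult)
  then have l: "cmod l = 1" using ne by (simp add: l_def norm_divide)
  moreover have "1 + cnj s * l \<noteq> 0"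
  proof
    assume "1 + cnj s * l = 0"
    then have "cnj s * l = -1" by (simp add: add_eq_0_iff)
    then have "cmod (cnj s * l) = 1" by simp
    then show False using s l by (simp add: norm_mult)
  qed
  moreover have "l + s = m * (1 + cnj s * l)"
  proof -
    have "l * (1 - cnj s * m) = m - s" using ne by (simp add: l_def)
    then show ?thesis by (simp add: algebra_simps)
  qed
  ultimately show ?thesis using that[of l] by simp
qed

text \<open>Conjugation by \<open>U\<close> moves the left factor \<open>U\<close> to the right end,
  so the two unitaries enter only through \<open>mat_adjoint V * U\<close>.\<close>

lemma char_poly_nelson_dilation:
  assumes "unitary_mat n U" "unitary_mat n V"
  shows "char_poly (nelson_dilation n U V b z) =
    char_poly (mat_diag n (\<lambda>i. b i z) * (mat_adjoint V * U))"
proof (rule char_poly_similar, rule similar_matI)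
  have c: "U \<in> carrier_mat n n" "V \<in> carrier_mat n n" using assms by (auto simp: unitary_mat_def)
  have UU: "U * mat_adjoint U = 1\<^sub>m n" "mat_adjoint U * U = 1\<^sub>m n" using assms by (auto simp: unitary_mat_def)
  show "{nelson_dilation n U V b z, mat_diag n (\<lambda>i. b i z) * (mat_adjoint V * U), U, mat_adjoint U} \<subseteq> carrier_mat n n"
    using c by (auto simp: nelson_dilation_def intro!: mult_carrier_mat[of _ n n])
  have "nelson_dilation n U V b z = U * (mat_diag n (\<lambda>i. b i z) * (mat_adjoint V * (U * mat_adjoint U)))"
    unfolding UU nelson_dilation_def using c by (simp add: assoc_mult_mat[of _ n n _ n _ n])
  then show "nelson_dilation n U V b z = U * (mat_diag n (\<lambda>i. b i z) * (mat_adjoint V * U)) * mat_adjoint U"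
    using c by (simp add: assoc_mult_mat[of _ n n _ n _ n])
qed (use assms in \<open>auto simp: unitary_mat_def\<close>)

text \<open>A circle with \<open>N\<close> points could not contain the \<open>N + 1\<close> roots
  of unity of order \<open>N + 1\<close>.\<close>

lemma infinite_unit_circle: "infinite {z :: complex. cmod z = 1}"
proof
  assume fin: "finite {z :: complex. cmod z = 1}"
  let ?n = "Suc (card {z :: complex. cmod z = 1})"
  have "{z :: complex. z ^ ?n = 1} \<subseteq> {z. cmod z = 1}"
  proof clarify
    fix z :: complex assume "z ^ ?n = 1"
    from power_eq_1_iff[OF this] show "cmod z = 1" by simp
  qed
  then have "card {z :: complex. z ^ ?n = 1} \<le> card {z :: complex. cmod z = 1}"
    by (rule card_mono[OF fin])
  moreover have "card {z :: complex. z ^ ?n = 1} = ?n"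
    by (rule card_roots_unity_eq) simp
  ultimately show False by simp
qed

lemma finite_repeated_eigenvalue_mobius_diag:
  fixes W :: "complex mat"
  assumes W: "W \<in> carrier_mat n n"
    and regular: "\<And>i. i < n \<Longrightarrow> 1 + d i * c \<noteq> 0"
    and simple: "\<not> repeated_eigenvalue (mat_diag n (\<lambda>i. (l i * c + s i) / (1 + d i * c)) * W)"
  shows "finite {z. repeated_eigenvalue (mat_diag n (\<lambda>i. (l i * z + s i) / (1 + d i * z)) * W)}"
proof -
  \<comment> \<open>\<open>q\<close> is the common denominator and \<open>p i\<close> the
    \<open>i\<close>-th fraction times \<open>q\<close>, so away from the zeros of \<open>q\<close>
    the polynomial matrix \<open>M\<close> is \<open>q\<close> times the given one.\<close>
  define q where "q = (\<Prod>j<n. [:1, d j:])"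
  define p where "p i = [:s i, l i:] * (\<Prod>j\<in>{..<n} - {i}. [:1, d j:])" for i
  define M where "M = mat n n (\<lambda>(i, j). p i * [:W $$ (i, j):])"
  have M: "M \<in> carrier_mat n n" unfolding M_def by simp
  have q0: "poly q z \<noteq> 0 \<longleftrightarrow> (\<forall>i<n. 1 + d i * z \<noteq> 0)" for z
    by (auto simp: q_def poly_prod mult.commute)
  have p: "poly (p i) z = poly q z * ((l i * z + s i) / (1 + d i * z))" if "poly q z \<noteq> 0" "i < n" for i z
  proof -
    have "poly q z = (1 + d i * z) * (\<Prod>j\<in>{..<n} - {i}. poly [:1, d j:] z)"
      unfolding q_def poly_prod using that(2) by (subst prod.remove[of _ i]) (auto simp: mult.commute)
    moreover have "1 + d i * z \<noteq> 0" using that q0 by auto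
    moreover have "poly (p i) z = (l i * z + s i) * (\<Prod>j\<in>{..<n} - {i}. poly [:1, d j:] z)"
      unfolding p_def poly_mult poly_prod by (simp add: algebra_simps)
    ultimately show ?thesis by simp
  qed
  have eval: "map_mat (\<lambda>p. poly p z) M = poly q z \<cdot>\<^sub>m (mat_diag n (\<lambda>i. (l i * z + s i) / (1 + d i * z)) * W)"
    if "poly q z \<noteq> 0" for z
    unfolding mat_diag_mult_left[OF W] M_def
    by (intro eq_matI) (auto simp: p[OF that])
  have iff: "repeated_eigenvalue (map_mat (\<lambda>p. poly p z) M) \<longleftrightarrow>
      repeated_eigenvalue (mat_diag n (\<lambda>i. (l i * z + s i) / (1 + d i * z)) * W)" if "poly q z \<noteq> 0" for z
    unfolding eval[OF that] by (rule repeated_eigenvalue_smult_iff[OF mult_carrier_mat[OF mat_diag_dim W] that])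
  have "poly q c \<noteq> 0" using regular q0 by simp
  then have "\<not> repeated_eigenvalue (map_mat (\<lambda>p. poly p c) M)" using simple iff by simp
  then have "finite {z. repeated_eigenvalue (map_mat (\<lambda>p. poly p z) M)}"
    by (rule finite_repeated_eigenvalue_poly_mat[OF M])
  moreover have "finite {z. poly q z = 0}"
    using \<open>poly q c \<noteq> 0\<close> by (intro poly_roots_finite) auto
  \<comment> \<open>The zeros of \<open>q\<close>, where a fraction takes a default value, are added
    wholesale; there are finitely many.\<close>
  ultimately have "finite ({z. repeated_eigenvalue (map_mat (\<lambda>p. poly p z) M)} \<union> {z. poly q z = 0})"
    by simp
  then show ?thesis by (rule rev_finite_subset) (use iff in auto)
qed

theorem theorem1p2:
  fixes n :: nat and T :: "complex mat"
  assumes "T \<in> carrier_mat n n"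
    and "op_norm T < 1"
  shows "\<exists>U V s b. nelson_data n T U V s b \<and> fractured n U V b"
proof -
  obtain U V s where U: "unitary_mat n U" and V: "unitary_mat n V"
    and T: "T = U * mat_diag n s * mat_adjoint V"
    using singular_value_decomposition[OF assms(1)] by blast
  have s: "cmod (s i) < 1" if "i < n" for i
    using cmod_singular_value_le_op_norm[OF U V T that] assms(2) by simp
  define W where "W = mat_adjoint V * U"
  have c: "U \<in> carrier_mat n n" "V \<in> carrier_mat n n" "mat_adjoint U * U = 1\<^sub>m n" "V * mat_adjoint V = 1\<^sub>m n"
    using U V by (auto simp: unitary_mat_def)
  have W: "W \<in> carrier_mat n n" unfolding W_def using c by simp
  have "(mat_adjoint U * V) * W = mat_adjoint U * ((V * mat_adjoint V) * U)"
    unfolding W_def using c(1,2) by (simp add: assoc_mult_mat[of _ n n _ n _ n])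
  then have W': "(mat_adjoint U * V) * W = 1\<^sub>m n"
    using c by simp
  have "mat_adjoint U * V \<in> carrier_mat n n" using c by simp
  then obtain \<mu> where \<mu>: "\<And>i. cmod (\<mu> i) = 1" and simple: "\<not> repeated_eigenvalue (mat_diag n \<mu> * W)"
    using ex_diag_mult_no_repeated_eigenvalue[OF W _ W' infinite_unit_circle] by auto
  \<comment> \<open>The rotations are chosen so that the automorphisms take the values \<mu> at
    \<open>z = 1\<close>; indices from \<open>n\<close> on get the dummy value 1.\<close>
  have "\<exists>l. cmod l = 1 \<and> (i < n \<longrightarrow> 1 + cnj (s i) * l \<noteq> 0 \<and> (l + s i) / (1 + cnj (s i) * l) = \<mu> i)" for i
  proof (cases "i < n")
    case True
    then show ?thesis using disk_automorphism_interpolation[OF s \<mu>, of i i] by metis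
  qed (auto intro: exI[of _ 1])
  then obtain l where l: "\<And>i. cmod (l i) = 1"
    and regular: "\<And>i. i < n \<Longrightarrow> 1 + cnj (s i) * l i \<noteq> 0"
    and value_1: "\<And>i. i < n \<Longrightarrow> (l i + s i) / (1 + cnj (s i) * l i) = \<mu> i"
    by metis
  \<comment> \<open>The parameter \<open>s i / l i\<close> lies in the disk and gives
    \<open>b i 0 = s i\<close>.\<close>
  define b where "b i z = l i * ((z + s i / l i) / (1 + cnj (s i / l i) * z))" for i z
  have l0: "l i \<noteq> 0" for i using l[of i] by auto
  have "l i * cnj (l i) = 1" for i using l[of i] by (metis complex_norm_square of_real_1 one_power2)
  then have cnj_a: "cnj (s i / l i) = cnj (s i) * l i" for i
    using l0[of i] by (simp add: divide_eq_eq ac_simps)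
  have b: "b i z = (l i * z + s i) / (1 + cnj (s i) * l i * z)" for i z
    unfolding b_def cnj_a using l0[of i] by (simp add: distrib_left)
  have "disk_automorphism (b i)" if "i < n" for i
    unfolding disk_automorphism_def using l[of i] s[OF that]
    by (intro exI[of _ "l i"] exI[of _ "s i / l i"]) (auto simp: b_def norm_divide)
  then have data: "nelson_data n T U V s b"
    unfolding nelson_data_def using U V T s by (simp add: b)
  have "mat_diag n (\<lambda>i. (l i * 1 + s i) / (1 + cnj (s i) * l i * 1)) = mat_diag n \<mu>"
    unfolding mat_diag_def using value_1 by (intro eq_matI) auto
  then have "finite {z. repeated_eigenvalue (mat_diag n (\<lambda>i. (l i * z + s i) / (1 + cnj (s i) * l i * z)) * W)}"
    using simple regular by (intro finite_repeated_eigenvalue_mobius_diag[OF W, where c = 1]) auto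
  moreover have "repeated_eigenvalue (nelson_dilation n U V b z) \<longleftrightarrow>
      repeated_eigenvalue (mat_diag n (\<lambda>i. (l i * z + s i) / (1 + cnj (s i) * l i * z)) * W)" for z
    unfolding repeated_eigenvalue_def char_poly_nelson_dilation[OF U V] by (simp only: b W_def)
  \<comment> \<open>Finiteness holds on the whole plane, hence on
    \<open>nelson_domain n b\<close>.\<close>
  ultimately have "fractured n U V b"
    unfolding fractured_def exceptional_set_def by simp
  then show ?thesis using data by blast
qed

end
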